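(* Let $\Delta$ and $\Delta'$ be finite thick generalized quadrangles, and let $\phi:\Delta\to\Delta'$ be a morphism which maps a geometrical hyperplane $\mathcal{G}$ of $\Delta$ surjectively onto a geometrical hyperplane $\mathcal{G}'$ of $\Delta'$, i.e. $\phi(\mathcal{G})=\mathcal{G}'$. Suppose $\mathcal{G}'$ is not of type B, and that if $\mathcal{G}'$ is of type C then $\mathcal{G}'$ is thick. Then $\phi$ is surjective.
   Context: A morphism of point-line geometries maps points to points, lines to lines and preserves incidence (it need not be injective). A generalized quadrangle is thick if every line has at least three points and every point is on at least three lines. A geometrical hyperplane of a thick GQ $\mathcal{S}$ is a subgeometry $\mathcal{S}'$ such that every line of $\mathcal{S}$ either has exactly one point in $\mathcal{S}'$ (and is not a line of $\mathcal{S}'$) or has all its points in $\mathcal{S}'$ (and is a line of $\mathcal{S}'$). There are three types: type A, $\mathcal{S}'$ is an ovoid (a point set meeting every line in exactly one point, with no lines); type B, $\mathcal{S}'$ is the geometry of all points collinear with a fixed point $x$ together with the lines through $x$; type C, $\mathcal{S}'$ is a proper full subquadrangle meeting every line (for $\mathcal{S}$ of order $(s,t)$, a subquadrangle of order $(s,t/s)$). *)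

theory Defs
  imports Main
begin

record ('p, 'l) geometry =
  Points :: "'p set"
  Lines :: "'l set"
  Inc :: "('p \<times> 'l) set"

definition point_line_geometry :: "('p, 'l) geometry \<Rightarrow> bool" where
  "point_line_geometry S \<longleftrightarrow> Inc S \<subseteq> Points S \<times> Lines S"

definition finite_geometry :: "('p, 'l) geometry \<Rightarrow> bool" where
  "finite_geometry S \<longleftrightarrow> finite (Points S) \<and> finite (Lines S)"

definition points_on :: "('p, 'l) geometry \<Rightarrow> 'l \<Rightarrow> 'p set" where
  "points_on S l = {p. (p, l) \<in> Inc S}"

definition lines_through :: "('p, 'l) geometry \<Rightarrow> 'p \<Rightarrow> 'l set" where
  "lines_through S p = {l. (p, l) \<in> Inc S}"

definition collinear :: "('p, 'l) geometry \<Rightarrow> 'p \<Rightarrow> 'p \<Rightarrow> bool" where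
  "collinear S p q \<longleftrightarrow> (\<exists>l. (p, l) \<in> Inc S \<and> (q, l) \<in> Inc S)"

(* Stated through a finite subset because card is 0 on infinite sets. *)
definition at_least :: "nat \<Rightarrow> 'a set \<Rightarrow> bool" where
  "at_least n X \<longleftrightarrow> (\<exists>A \<subseteq> X. finite A \<and> card A = n)"

(* Thickness is not part of this notion, so that subquadrangles may be grids or dual
   grids; no order (s,t) is assumed, as it exists automatically in the thick case. *)
definition generalized_quadrangle :: "('p, 'l) geometry \<Rightarrow> bool" where
  "generalized_quadrangle S \<longleftrightarrow>
     point_line_geometry S \<and> Points S \<noteq> {} \<and>
     (\<forall>l \<in> Lines S. at_least 2 (points_on S l)) \<and>
     (\<forall>p \<in> Points S. at_least 2 (lines_through S p)) \<and>
     (\<forall>p q l m. (p, l) \<in> Inc S \<and> (q, l) \<in> Inc S \<and> (p, m) \<in> Inc S \<and> (q, m) \<in> Inc S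
        \<longrightarrow> p = q \<or> l = m) \<and>
     (\<forall>p \<in> Points S. \<forall>l \<in> Lines S. (p, l) \<notin> Inc S \<longrightarrow>
        (\<exists>!(q, m). (p, m) \<in> Inc S \<and> (q, m) \<in> Inc S \<and> (q, l) \<in> Inc S))"

definition thick :: "('p, 'l) geometry \<Rightarrow> bool" where
  "thick S \<longleftrightarrow>
     (\<forall>l \<in> Lines S. at_least 3 (points_on S l)) \<and>
     (\<forall>p \<in> Points S. at_least 3 (lines_through S p))"

definition subgeometry :: "('p, 'l) geometry \<Rightarrow> ('p, 'l) geometry \<Rightarrow> bool" where
  "subgeometry S' S \<longleftrightarrow>
     Points S' \<subseteq> Points S \<and> Lines S' \<subseteq> Lines S \<and>
     Inc S' = Inc S \<inter> (Points S' \<times> Lines S')"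

(* Hyperplanes are proper: the whole geometry is of none of the types A, B, C. *)
definition geometrical_hyperplane :: "('p, 'l) geometry \<Rightarrow> ('p, 'l) geometry \<Rightarrow> bool" where
  "geometrical_hyperplane S' S \<longleftrightarrow>
     subgeometry S' S \<and> S' \<noteq> S \<and>
     (\<forall>l \<in> Lines S.
        ((\<exists>!p. p \<in> points_on S l \<and> p \<in> Points S') \<and> l \<notin> Lines S') \<or>
        (points_on S l \<subseteq> Points S' \<and> l \<in> Lines S'))"

definition hyperplane_type_B :: "('p, 'l) geometry \<Rightarrow> ('p, 'l) geometry \<Rightarrow> bool" where
  "hyperplane_type_B S' S \<longleftrightarrow>
     geometrical_hyperplane S' S \<and>
     (\<exists>x \<in> Points S. Points S' = {y \<in> Points S. collinear S x y} \<and>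
        Lines S' = lines_through S x)"

definition full_subquadrangle :: "('p, 'l) geometry \<Rightarrow> ('p, 'l) geometry \<Rightarrow> bool" where
  "full_subquadrangle S' S \<longleftrightarrow>
     subgeometry S' S \<and> generalized_quadrangle S' \<and>
     (\<forall>l \<in> Lines S'. points_on S l \<subseteq> Points S')"

definition hyperplane_type_C :: "('p, 'l) geometry \<Rightarrow> ('p, 'l) geometry \<Rightarrow> bool" where
  "hyperplane_type_C S' S \<longleftrightarrow>
     geometrical_hyperplane S' S \<and> full_subquadrangle S' S \<and> S' \<noteq> S \<and>
     (\<forall>l \<in> Lines S. points_on S l \<inter> Points S' \<noteq> {})"

definition morphism ::
  "('p, 'l) geometry \<Rightarrow> ('q, 'm) geometry \<Rightarrow> ('p \<Rightarrow> 'q) \<Rightarrow> ('l \<Rightarrow> 'm) \<Rightarrow> bool" where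
  "morphism S T f g \<longleftrightarrow>
     f ` Points S \<subseteq> Points T \<and> g ` Lines S \<subseteq> Lines T \<and>
     (\<forall>p l. (p, l) \<in> Inc S \<longrightarrow> (f p, g l) \<in> Inc T)"

definition maps_onto ::
  "('p \<Rightarrow> 'q) \<Rightarrow> ('l \<Rightarrow> 'm) \<Rightarrow> ('p, 'l) geometry \<Rightarrow> ('q, 'm) geometry \<Rightarrow> bool" where
  "maps_onto f g S T \<longleftrightarrow> f ` Points S = Points T \<and> g ` Lines S = Lines T"

end

theory Submission
  imports Defs
begin

text \<open>
  The image of \<open>\<phi>\<close> is closed under projecting points onto lines. If it contains \<open>\<G>'\<close> and a line
  \<open>l\<close> outside \<open>\<G>'\<close>, then every line through a point \<open>y\<close> of \<open>l\<close> outside \<open>\<G>'\<close> carries a point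
  of \<open>\<G>'\<close>, whose projection onto \<open>l\<close> is \<open>y\<close>; hence all these lines are in the image, and the
  image spreads over the complement of \<open>\<G>'\<close>. Otherwise \<open>\<phi>\<close> maps \<open>\<Delta>\<close> onto \<open>\<G>'\<close>, which then has
  lines, so it is of type C and a thick quadrangle. An epimorphism of finite thick quadrangles is
  injective (Pasini): all its fibres on lines have one size \<open>m\<close>, and all its fibres on pencils one
  size \<open>n\<close>, and counting a point fibre in two ways gives \<open>m + 2mn(m - 1) \<le> m\<^sup>2 n\<close>, so \<open>m = 1\<close>, and
  dually \<open>n = 1\<close>. Injectivity contradicts \<open>\<phi>(\<G>) = \<G>' = \<phi>(\<Delta>)\<close> as \<open>\<G>\<close> is proper.
\<close>

section \<open>Elements avoiding one or two given ones\<close>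

lemma at_least_3_obtain:
  assumes "at_least 3 X"
  obtains z where "z \<in> X" "z \<noteq> a" "z \<noteq> b"
proof -
  obtain A where A: "A \<subseteq> X" "finite A" "card A = 3"
    using assms unfolding at_least_def by blast
  have "\<not> A \<subseteq> {a, b}"
  proof
    assume "A \<subseteq> {a, b}"
    then have "card A \<le> card {a, b}" by (intro card_mono) auto
    also have "\<dots> \<le> 2" by (simp add: card_insert_if)
    finally show False using A by simp
  qed
  then show ?thesis using A that by blast
qed

lemma at_least_2_obtain:
  assumes "at_least 2 X"
  obtains z where "z \<in> X" "z \<noteq> a"
proof -
  obtain A where A: "A \<subseteq> X" "finite A" "card A = 2"
    using assms unfolding at_least_def by blast
  have "\<not> A \<subseteq> {a}"
  proof
    assume "A \<subseteq> {a}"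
    then have "card A \<le> card {a}" by (intro card_mono) auto
    then show False using A by simp
  qed
  then show ?thesis using A that by blast
qed

lemma at_least_2I:
  assumes "a \<in> X" "b \<in> X" "a \<noteq> b"
  shows "at_least 2 X"
  unfolding at_least_def using assms by (intro exI[of _ "{a, b}"]) auto

section \<open>Generalized quadrangles\<close>

locale gen_quad =
  fixes S :: "('p, 'l) geometry"
  assumes gq: "generalized_quadrangle S"
begin

lemma Inc_Points: "(p, l) \<in> Inc S \<Longrightarrow> p \<in> Points S"
  and Inc_Lines: "(p, l) \<in> Inc S \<Longrightarrow> l \<in> Lines S"
  using gq unfolding generalized_quadrangle_def point_line_geometry_def by auto

lemma join_unique:
  assumes "(p, l) \<in> Inc S" "(q, l) \<in> Inc S" "(p, m) \<in> Inc S" "(q, m) \<in> Inc S" "p \<noteq> q"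
  shows "l = m"
proof -
  have "p = q \<or> l = m"
    using gq assms(1-4) unfolding generalized_quadrangle_def by blast
  then show ?thesis using assms(5) by simp
qed

lemma proj_obtain:
  assumes "p \<in> Points S" "l \<in> Lines S" "(p, l) \<notin> Inc S"
  obtains q m where "(p, m) \<in> Inc S" "(q, m) \<in> Inc S" "(q, l) \<in> Inc S"
proof -
  have "\<exists>!(q, m). (p, m) \<in> Inc S \<and> (q, m) \<in> Inc S \<and> (q, l) \<in> Inc S"
    using gq assms unfolding generalized_quadrangle_def by blast
  then show ?thesis using that by auto
qed

lemma proj_unique:
  assumes "(p, l) \<notin> Inc S"
    and "(p, m) \<in> Inc S" "(q, m) \<in> Inc S" "(q, l) \<in> Inc S"
    and "(p, m') \<in> Inc S" "(q', m') \<in> Inc S" "(q', l) \<in> Inc S"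
  shows "q = q'" and "m = m'"
proof -
  have "\<exists>!(q, m). (p, m) \<in> Inc S \<and> (q, m) \<in> Inc S \<and> (q, l) \<in> Inc S"
    using gq assms Inc_Points Inc_Lines unfolding generalized_quadrangle_def by blast
  then have "(q, m) = (q', m')" using assms by auto
  then show "q = q'" "m = m'" by auto
qed

text \<open>A triangle would give \<open>a\<close> two projections onto \<open>l\<close>:
  \<open>b\<close> along \<open>k\<close> and \<open>c\<close> along \<open>m\<close>.\<close>

lemma no_triangle:
  assumes "(a, k) \<in> Inc S" "(b, k) \<in> Inc S" "(b, l) \<in> Inc S" "(c, l) \<in> Inc S"
    and "(c, m) \<in> Inc S" "(a, m) \<in> Inc S" "a \<noteq> b" "k \<noteq> l"
  shows "m = k \<or> c = a \<or> m = l"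
proof -
  have "(a, l) \<notin> Inc S" using assms join_unique by blast
  then show ?thesis using proj_unique[of a l k b m c] assms by auto
qed

lemma line_obtain:
  assumes "p \<in> Points S"
  obtains l where "(p, l) \<in> Inc S" "l \<noteq> m"
proof -
  have "at_least 2 (lines_through S p)"
    using gq assms unfolding generalized_quadrangle_def by blast
  then show ?thesis using that by (elim at_least_2_obtain[where a = m]) (auto simp: lines_through_def)
qed

lemma point_obtain:
  assumes "l \<in> Lines S"
  obtains p where "(p, l) \<in> Inc S" "p \<noteq> q"
proof -
  have "at_least 2 (points_on S l)"
    using gq assms unfolding generalized_quadrangle_def by blast
  then show ?thesis using that by (elim at_least_2_obtain[where a = q]) (auto simp: points_on_def)
qed

lemma Points_nonempty: "Points S \<noteq> {}"
  using gq unfolding generalized_quadrangle_def by blast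

text \<open>Walking from \<open>l\<close> along \<open>m\<close> to \<open>k\<close> suffices: if
  \<open>k\<close> met \<open>l\<close>, then \<open>y\<close> would project onto \<open>l\<close>
  both along \<open>m\<close> and along \<open>k\<close>.\<close>

lemma disjoint_line_obtain:
  assumes "l \<in> Lines S"
  obtains k where "k \<in> Lines S" "\<And>p. (p, k) \<in> Inc S \<Longrightarrow> (p, l) \<notin> Inc S"
proof -
  obtain x where x: "(x, l) \<in> Inc S" using point_obtain assms by blast
  obtain m where m: "(x, m) \<in> Inc S" "m \<noteq> l" using line_obtain Inc_Points[OF x] by blast
  obtain y where y: "(y, m) \<in> Inc S" "y \<noteq> x" using point_obtain Inc_Lines[OF m(1)] by blast
  obtain k where k: "(y, k) \<in> Inc S" "k \<noteq> m" using line_obtain Inc_Points[OF y(1)] by blast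
  have "(p, l) \<notin> Inc S" if p: "(p, k) \<in> Inc S" for p
  proof
    assume pl: "(p, l) \<in> Inc S"
    have "(y, l) \<notin> Inc S" using x m y join_unique by blast
    then show False using proj_unique[of y l m x k p] x m y k p pl by auto
  qed
  then show ?thesis using that Inc_Lines[OF k(1)] by blast
qed

end

locale thick_gen_quad = gen_quad +
  assumes thick: "thick S"
begin

lemma third_line_obtain:
  assumes "p \<in> Points S"
  obtains l where "(p, l) \<in> Inc S" "l \<noteq> m" "l \<noteq> k"
proof -
  have "at_least 3 (lines_through S p)" using thick assms unfolding thick_def by blast
  then show ?thesis using that
    by (elim at_least_3_obtain[where a = m and b = k]) (auto simp: lines_through_def)
qed

lemma third_point_obtain:
  assumes "l \<in> Lines S"
  obtains p where "(p, l) \<in> Inc S" "p \<noteq> q" "p \<noteq> r"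
proof -
  have "at_least 3 (points_on S l)" using thick assms unfolding thick_def by blast
  then show ?thesis using that
    by (elim at_least_3_obtain[where a = q and b = r]) (auto simp: points_on_def)
qed

end

section \<open>Duality between points and lines\<close>

definition dual :: "('p, 'l) geometry \<Rightarrow> ('l, 'p) geometry" where
  "dual S = \<lparr>Points = Lines S, Lines = Points S, Inc = (Inc S)\<inverse>\<rparr>"

lemma dual_simps [simp]:
  "Points (dual S) = Lines S" "Lines (dual S) = Points S"
  "(l, p) \<in> Inc (dual S) \<longleftrightarrow> (p, l) \<in> Inc S"
  "points_on (dual S) p = lines_through S p" "lines_through (dual S) l = points_on S l"
  by (auto simp: dual_def points_on_def lines_through_def)

lemma thick_dual: "thick S \<Longrightarrow> thick (dual S)"
  by (auto simp: thick_def)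

lemma (in gen_quad) generalized_quadrangle_dual: "generalized_quadrangle (dual S)"
proof -
  obtain p where "p \<in> Points S" using Points_nonempty by blast
  then have "Lines S \<noteq> {}" using line_obtain[of p] Inc_Lines by blast
  moreover have "\<exists>!(m, q). (q, l) \<in> Inc S \<and> (q, m) \<in> Inc S \<and> (p, m) \<in> Inc S"
    if pl: "p \<in> Points S" "l \<in> Lines S" "(p, l) \<notin> Inc S" for p l
  proof -
    obtain q m where qm: "(p, m) \<in> Inc S" "(q, m) \<in> Inc S" "(q, l) \<in> Inc S"
      using proj_obtain[OF pl] by metis
    show ?thesis
    proof (rule ex1I[of _ "(m, q)"])
      show "case (m, q) of (m, q) \<Rightarrow> (q, l) \<in> Inc S \<and> (q, m) \<in> Inc S \<and> (p, m) \<in> Inc S"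
        using qm by simp
      fix z assume "case z of (m, q) \<Rightarrow> (q, l) \<in> Inc S \<and> (q, m) \<in> Inc S \<and> (p, m) \<in> Inc S"
      then show "z = (m, q)"
        using proj_unique[OF pl(3) qm] by (cases z) auto
    qed
  qed
  moreover have "\<forall>l\<in>Lines S. at_least 2 (points_on S l)" "\<forall>p\<in>Points S. at_least 2 (lines_through S p)"
    using gq unfolding generalized_quadrangle_def by blast+
  ultimately show ?thesis
    unfolding generalized_quadrangle_def point_line_geometry_def
    using Inc_Points Inc_Lines join_unique by (auto simp: dual_def points_on_def lines_through_def)
qed

section \<open>Epimorphisms\<close>

text \<open>Thickness of the target supplies the third line, and dually the third point, through
  which fibres are compared. In the main theorem the target is the hyperplane \<open>\<G>'\<close>,
  taken as a quadrangle of its own.\<close>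

locale gq_epi = S: gen_quad S + T: thick_gen_quad T
  for S :: "('p, 'l) geometry" and T :: "('q, 'm) geometry" +
  fixes f :: "'p \<Rightarrow> 'q" and g :: "'l \<Rightarrow> 'm"
  assumes finite: "finite_geometry S"
    and mor: "morphism S T f g"
    and onto: "maps_onto f g S T"
begin

lemma Inc_image: "(p, l) \<in> Inc S \<Longrightarrow> (f p, g l) \<in> Inc T"
  using mor unfolding morphism_def by blast

lemma f_Points: "p \<in> Points S \<Longrightarrow> f p \<in> Points T"
  using mor unfolding morphism_def by auto

lemma preimage_point:
  assumes "(y, M) \<in> Inc T"
  obtains x where "x \<in> Points S" "f x = y"
proof -
  have "y \<in> f ` Points S" using onto T.Inc_Points[OF assms] unfolding maps_onto_def by simp
  then show ?thesis using that by auto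
qed

lemma preimage_line:
  assumes "(y, M) \<in> Inc T"
  obtains l where "l \<in> Lines S" "g l = M"
proof -
  have "M \<in> g ` Lines S" using onto T.Inc_Lines[OF assms] unfolding maps_onto_def by simp
  then show ?thesis using that by auto
qed

text \<open>The assumptions are self-dual, so each fact about points of a line yields one about
  lines of a pencil.\<close>

lemma gq_epi_dual: "gq_epi (dual S) (dual T) g f"
proof
  show "generalized_quadrangle (dual S)" "generalized_quadrangle (dual T)"
    by (rule S.generalized_quadrangle_dual T.generalized_quadrangle_dual)+
  show "thick (dual T)" using thick_dual T.thick .
  show "finite_geometry (dual S)" using finite unfolding finite_geometry_def by simp
  show "morphism (dual S) (dual T) g f" using mor unfolding morphism_def by simp
  show "maps_onto g f (dual S) (dual T)" using onto unfolding maps_onto_def by simp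
qed

text \<open>The projection of \<open>x\<close> onto \<open>l\<close> maps to a projection of
  \<open>f x\<close> onto \<open>g l\<close>, and that one is unique in \<open>T\<close>.\<close>

lemma proj_lift:
  assumes "x \<in> Points S" "l \<in> Lines S" "(f x, g l) \<notin> Inc T"
    and "(f x, M) \<in> Inc T" "(y, M) \<in> Inc T" "(y, g l) \<in> Inc T"
  obtains q m where "(x, m) \<in> Inc S" "(q, m) \<in> Inc S" "(q, l) \<in> Inc S" "f q = y" "g m = M"
proof -
  obtain q m where qm: "(x, m) \<in> Inc S" "(q, m) \<in> Inc S" "(q, l) \<in> Inc S"
    using S.proj_obtain assms Inc_image by metis
  then have "f q = y" "g m = M"
    using T.proj_unique[OF assms(3) _ _ _ assms(4-6)] Inc_image by blast+
  then show ?thesis using that qm by blast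
qed

text \<open>A preimage of a point \<open>z'\<close> collinear with \<open>y\<close> but off
  \<open>g l\<close> projects onto \<open>l\<close> at a point over \<open>y\<close>. Global
  surjectivity thus becomes surjectivity on each line.\<close>

lemma lift_point:
  assumes "l \<in> Lines S" "(y, g l) \<in> Inc T"
  obtains x where "(x, l) \<in> Inc S" "f x = y"
proof -
  obtain M where M: "(y, M) \<in> Inc T" "M \<noteq> g l"
    using T.line_obtain T.Inc_Points[OF assms(2)] by metis
  obtain z' where z': "(z', M) \<in> Inc T" "z' \<noteq> y" using T.point_obtain T.Inc_Lines[OF M(1)] by metis
  obtain z where z: "z \<in> Points S" "f z = z'"
    using preimage_point[OF z'(1)] by blast
  have "(z', g l) \<notin> Inc T" using T.join_unique z' M assms(2) by blast
  then show ?thesis using proj_lift[of z l M y] z assms z' M that by blast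
qed

section \<open>Sizes of fibres on lines and pencils\<close>

definition point_fibre :: "'l \<Rightarrow> 'q \<Rightarrow> 'p set" where
  "point_fibre l y = {x. (x, l) \<in> Inc S \<and> f x = y}"

definition line_fibre :: "'p \<Rightarrow> 'm \<Rightarrow> 'l set" where
  "line_fibre x M = {l. (x, l) \<in> Inc S \<and> g l = M}"

lemma finite_point_fibre: "finite (point_fibre l y)"
  using finite S.Inc_Points unfolding finite_geometry_def point_fibre_def
  by (metis (mono_tags, lifting) finite_subset mem_Collect_eq subsetI)

lemma finite_line_fibre: "finite (line_fibre x M)"
  using finite S.Inc_Lines unfolding finite_geometry_def line_fibre_def
  by (metis (mono_tags, lifting) finite_subset mem_Collect_eq subsetI)

text \<open>Projecting onto \<open>k\<close> sends points of \<open>l\<close> over \<open>y\<close>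
  to points over \<open>z\<close>, injectively, since each point is recovered by projecting back
  onto \<open>l\<close>. The hypotheses are symmetric in the two sides, so two applications give
  equality.\<close>

lemma card_point_fibre_le:
  assumes l: "l \<in> Lines S" and k: "k \<in> Lines S"
    and y: "(y, g l) \<in> Inc T" "(y, N) \<in> Inc T" and z: "(z, N) \<in> Inc T" "(z, g k) \<in> Inc T"
    and ne: "y \<noteq> z" "g l \<noteq> N" "g k \<noteq> N"
  shows "card (point_fibre l y) \<le> card (point_fibre k z)"
proof -
  have yk: "(y, g k) \<notin> Inc T" and zl: "(z, g l) \<notin> Inc T"
    using T.join_unique y z ne by blast+
  have "\<forall>x\<in>point_fibre l y. \<exists>q. q \<in> point_fibre k z \<and> (\<exists>m. (x, m) \<in> Inc S \<and> (q, m) \<in> Inc S)"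
  proof
    fix x assume "x \<in> point_fibre l y"
    then have x: "(x, l) \<in> Inc S" "f x = y" by (auto simp: point_fibre_def)
    have "(f x, g k) \<notin> Inc T" "(f x, N) \<in> Inc T" using yk y(2) x(2) by simp_all
    then obtain q m where "(x, m) \<in> Inc S" "(q, m) \<in> Inc S" "(q, k) \<in> Inc S" "f q = z"
      using proj_lift[OF S.Inc_Points[OF x(1)] k _ _ z] by metis
    then show "\<exists>q. q \<in> point_fibre k z \<and> (\<exists>m. (x, m) \<in> Inc S \<and> (q, m) \<in> Inc S)"
      by (auto simp: point_fibre_def)
  qed
  then obtain h where h: "\<And>x. x \<in> point_fibre l y \<Longrightarrow>
      h x \<in> point_fibre k z \<and> (\<exists>m. (x, m) \<in> Inc S \<and> (h x, m) \<in> Inc S)"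
    by metis
  have "inj_on h (point_fibre l y)"
  proof (rule inj_onI)
    fix a b assume a: "a \<in> point_fibre l y" and b: "b \<in> point_fibre l y" and eq: "h a = h b"
    have "(h a, l) \<notin> Inc S" using h[OF a] zl Inc_image unfolding point_fibre_def by blast
    moreover obtain m where "(a, m) \<in> Inc S" "(h a, m) \<in> Inc S" using h[OF a] by blast
    moreover obtain m' where "(b, m') \<in> Inc S" "(h a, m') \<in> Inc S" using h[OF b] eq by auto
    ultimately show "a = b"
      using S.proj_unique(1) a b unfolding point_fibre_def by blast
  qed
  then show ?thesis
    using h finite_point_fibre by (intro card_inj_on_le[of h]) auto
qed

text \<open>Both fibres are compared with one fibre over a neighbour \<open>u\<close> of
  \<open>y\<close>, joined to \<open>y\<close> by a third line \<open>N\<close> different from the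
  images of \<open>l\<close> and \<open>k\<close>.\<close>

lemma card_point_fibre_same:
  assumes "l \<in> Lines S" "k \<in> Lines S" "(y, g l) \<in> Inc T" "(y, g k) \<in> Inc T"
  shows "card (point_fibre l y) = card (point_fibre k y)"
proof -
  obtain N where N: "(y, N) \<in> Inc T" "N \<noteq> g l" "N \<noteq> g k"
    using T.third_line_obtain T.Inc_Points[OF assms(3)] by metis
  obtain u where u: "(u, N) \<in> Inc T" "u \<noteq> y" using T.point_obtain T.Inc_Lines[OF N(1)] by metis
  obtain J where J: "(u, J) \<in> Inc T" "J \<noteq> N" using T.line_obtain T.Inc_Points[OF u(1)] by metis
  obtain j where j: "j \<in> Lines S" "g j = J"
    using preimage_line[OF J(1)] by blast
  have "card (point_fibre l y) = card (point_fibre j u)"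
    using assms N u J j by (intro antisym card_point_fibre_le[where N = N]) auto
  moreover have "card (point_fibre k y) = card (point_fibre j u)"
    using assms N u J j by (intro antisym card_point_fibre_le[where N = N]) auto
  ultimately show ?thesis by simp
qed

text \<open>The projection argument excludes lines mapped to \<open>N\<close>. Lines
  \<open>a\<close> and \<open>b\<close> with other images replace \<open>l\<close> and
  \<open>k\<close> without changing the fibre sizes over \<open>y\<close> and
  \<open>z\<close>.\<close>

lemma card_point_fibre_collinear:
  assumes "l \<in> Lines S" "k \<in> Lines S" "(y, g l) \<in> Inc T" "(z, g k) \<in> Inc T"
    and "(y, N) \<in> Inc T" "(z, N) \<in> Inc T"
  shows "card (point_fibre l y) = card (point_fibre k z)"
proof (cases "y = z")
  case True
  then show ?thesis using card_point_fibre_same assms by blast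
next
  case False
  obtain A where A: "(y, A) \<in> Inc T" "A \<noteq> N" using T.line_obtain T.Inc_Points[OF assms(3)] by metis
  obtain a where a: "a \<in> Lines S" "g a = A"
    using preimage_line[OF A(1)] by blast
  obtain B where B: "(z, B) \<in> Inc T" "B \<noteq> N" using T.line_obtain T.Inc_Points[OF assms(4)] by metis
  obtain b where b: "b \<in> Lines S" "g b = B"
    using preimage_line[OF B(1)] by blast
  have "card (point_fibre l y) = card (point_fibre a y)"
    using assms A a by (intro card_point_fibre_same) auto
  also have "\<dots> = card (point_fibre b z)"
    using assms A a B b False by (intro antisym card_point_fibre_le[where N = N]) auto
  also have "\<dots> = card (point_fibre k z)"
    using assms B b by (intro card_point_fibre_same) auto
  finally show ?thesis .
qed

lemma card_line_fibre_concurrent: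
  assumes "x \<in> Points S" "w \<in> Points S" "(f x, M) \<in> Inc T" "(f w, N) \<in> Inc T"
    and "(u, M) \<in> Inc T" "(u, N) \<in> Inc T"
  shows "card (line_fibre x M) = card (line_fibre w N)"
proof -
  interpret D: gq_epi "dual S" "dual T" g f by (rule gq_epi_dual)
  have "D.point_fibre = line_fibre"
    by (intro ext) (simp add: D.point_fibre_def line_fibre_def)
  then show ?thesis using D.card_point_fibre_collinear[of x w M N u] assms by simp
qed

lemma lift_line:
  assumes "x \<in> Points S" "(f x, M) \<in> Inc T"
  obtains l where "(x, l) \<in> Inc S" "g l = M"
proof -
  interpret D: gq_epi "dual S" "dual T" g f by (rule gq_epi_dual)
  show ?thesis using D.lift_point[of x M] assms that by auto
qed

text \<open>Two points of \<open>l\<close> over \<open>c\<close> would make the whole fibre over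
  \<open>c\<close> too large. It is bounded above by projecting it onto a line whose image misses
  \<open>c\<close>, and below by its points on \<open>l\<close> and on lines leaving
  \<open>l\<close>.\<close>

lemma inj_on_line:
  assumes xl: "(x, l) \<in> Inc S" and wl: "(w, l) \<in> Inc S" and fxw: "f x = f w"
  shows "x = w"
proof (rule ccontr)
  assume xw: "x \<noteq> w"
  define c where "c = f x"
  define m where "m = card (point_fibre l c)"
  have x: "x \<in> Points S" and l: "l \<in> Lines S" using xl S.Inc_Points S.Inc_Lines by auto
  have cl: "(c, g l) \<in> Inc T" unfolding c_def using xl Inc_image by blast
  have cT: "c \<in> Points T" using T.Inc_Points cl by blast
  have "{x, w} \<subseteq> point_fibre l c" using xl wl fxw by (auto simp: point_fibre_def c_def)
  then have "card {x, w} \<le> m" unfolding m_def by (rule card_mono[OF finite_point_fibre])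
  then have m2: "m \<ge> 2" using xw by simp
  obtain M where M: "(c, M) \<in> Inc T" "M \<noteq> g l" using T.line_obtain cT by metis
  \<comment> \<open>A second line besides \<open>M\<close> doubles the main term of the lower bound;
    with \<open>M\<close> alone the two bounds would be compatible.\<close>
  obtain M' where M': "(c, M') \<in> Inc T" "M' \<noteq> g l" "M' \<noteq> M" using T.third_line_obtain cT by metis
  obtain y where y: "(y, M) \<in> Inc T" "y \<noteq> c" using T.point_obtain T.Inc_Lines[OF M(1)] by metis
  obtain K where K: "(y, K) \<in> Inc T" "K \<noteq> M" using T.line_obtain T.Inc_Points[OF y(1)] by metis
  obtain k where k: "k \<in> Lines S" "g k = K"
    using preimage_line[OF K(1)] by blast
  have cK: "(c, K) \<notin> Inc T" using T.join_unique M(1) y K by metis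
  define n where "n = card (line_fibre x M)"
  have nM: "card (line_fibre v M) = n" if "v \<in> Points S" "(f v, M) \<in> Inc T" for v
    unfolding n_def using that x M(1) by (intro card_line_fibre_concurrent) (auto simp: c_def)
  have nM': "card (line_fibre v M') = n" if "v \<in> Points S" "(f v, M') \<in> Inc T" for v
    unfolding n_def using that x M(1) M'(1)
    by (intro card_line_fibre_concurrent[where u = c]) (auto simp: c_def)
  have mc: "card (point_fibre j c) = m" if "j \<in> Lines S" "(c, g j) \<in> Inc T" for j
    unfolding m_def using that l cl by (intro card_point_fibre_same) auto
  have my: "card (point_fibre k y) = m"
    unfolding m_def using l k cl K M(1) y(1)
    by (intro card_point_fibre_collinear[where N = M]) auto
  have "n \<noteq> 0"
  proof -
    obtain j where "(x, j) \<in> Inc S" "g j = M" using lift_line[of x M] x M(1) c_def by auto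
    then have "line_fibre x M \<noteq> {}" by (auto simp: line_fibre_def)
    then show ?thesis unfolding n_def using finite_line_fibre by simp
  qed
  define F where "F = {v \<in> Points S. f v = c}"
  have finF: "finite F" using finite unfolding F_def finite_geometry_def by simp

  \<comment> \<open>Every point over \<open>c\<close> projects onto \<open>k\<close> at a point over
    \<open>y\<close>, along a line over \<open>M\<close>. So the triples (foot, line, point) cover
    \<open>F\<close>, with \<open>m\<close>, \<open>n\<close> and \<open>m\<close> choices in
    turn.\<close>
  define U where "U = (SIGMA q:point_fibre k y. SIGMA j:line_fibre q M. point_fibre j c)"
  have finU: "finite U"
    unfolding U_def by (intro finite_SigmaI finite_point_fibre finite_line_fibre)
  have "F \<subseteq> (snd \<circ> snd) ` U"
  proof
    fix v assume "v \<in> F"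
    then have v: "v \<in> Points S" "f v = c" by (auto simp: F_def)
    obtain q j where "(v, j) \<in> Inc S" "(q, j) \<in> Inc S" "(q, k) \<in> Inc S" "f q = y" "g j = M"
      using proj_lift[of v k M y] v k cK M(1) y(1) K(1) by blast
    then have "(q, j, v) \<in> U"
      using v by (auto simp: U_def point_fibre_def line_fibre_def)
    then show "v \<in> (snd \<circ> snd) ` U" by force
  qed
  then have "card F \<le> card U" using finU by (meson card_image_le card_mono finite_imageI le_trans)
  also have "card U = (\<Sum>q\<in>point_fibre k y. card (SIGMA j:line_fibre q M. point_fibre j c))"
    unfolding U_def
    by (intro card_SigmaI ballI finite_SigmaI finite_point_fibre finite_line_fibre)
  also have "\<dots> = (\<Sum>q\<in>point_fibre k y. n * m)"
  proof (rule sum.cong[OF refl])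
    fix q assume "q \<in> point_fibre k y"
    then have q: "q \<in> Points S" "(f q, M) \<in> Inc T" using S.Inc_Points y(1) by (auto simp: point_fibre_def)
    have "card (SIGMA j:line_fibre q M. point_fibre j c) = (\<Sum>j\<in>line_fibre q M. card (point_fibre j c))"
      by (intro card_SigmaI ballI finite_point_fibre finite_line_fibre)
    also have "\<dots> = (\<Sum>j\<in>line_fibre q M. m)"
      using S.Inc_Lines M(1) by (intro sum.cong refl mc) (auto simp: line_fibre_def)
    finally show "card (SIGMA j:line_fibre q M. point_fibre j c) = n * m"
      using nM[OF q] by simp
  qed
  finally have upper: "card F \<le> m * (n * m)" using my by simp

  define P where "P v = line_fibre v M \<union> line_fibre v M'" for v
  have finP: "finite (P v)" for v unfolding P_def by (simp add: finite_line_fibre)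
  \<comment> \<open>Each point \<open>v\<close> of \<open>l\<close> over \<open>c\<close> is left
    along a line over \<open>M\<close> or \<open>M'\<close> towards another point over
    \<open>c\<close>. No point is reached twice: it lies off \<open>l\<close>, and its projection
    onto \<open>l\<close> determines \<open>v\<close> and the line.\<close>
  define D where "D = (SIGMA v:point_fibre l c. SIGMA j:P v. point_fibre j c - {v})"
  have D: "(v, l) \<in> Inc S" "(v, j) \<in> Inc S" "(u, j) \<in> Inc S" "(u, l) \<notin> Inc S" "f u = c"
    if "(v, j, u) \<in> D" for v j u
  proof -
    show *: "(v, l) \<in> Inc S" "(v, j) \<in> Inc S" "(u, j) \<in> Inc S" "f u = c"
      using that by (auto simp: D_def P_def point_fibre_def line_fibre_def)
    have "u \<noteq> v" "j \<noteq> l" using that M(2) M'(2)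
      by (auto simp: D_def P_def line_fibre_def)
    then show "(u, l) \<notin> Inc S" using * S.join_unique by blast
  qed
  have finD: "finite D"
    unfolding D_def by (intro finite_SigmaI finite_point_fibre finP finite_Diff)
  have inj: "inj_on (snd \<circ> snd) D"
  proof (rule inj_onI)
    fix a b assume a: "a \<in> D" and b: "b \<in> D" and eq: "(snd \<circ> snd) a = (snd \<circ> snd) b"
    obtain v j u where a': "a = (v, j, u)" by (cases a) auto
    obtain v' j' where b': "b = (v', j', u)" using eq a' by (cases b) auto
    note Da = D[OF a[unfolded a']] and Db = D[OF b[unfolded b']]
    show "a = b"
      using S.proj_unique[OF Da(4) Da(3,2,1) Db(3,2,1)] a' b' by simp
  qed
  have sub: "point_fibre l c \<union> (snd \<circ> snd) ` D \<subseteq> F"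
  proof -
    have "point_fibre l c \<subseteq> F" using S.Inc_Points by (auto simp: F_def point_fibre_def)
    moreover have "(snd \<circ> snd) ` D \<subseteq> F"
    proof
      fix u assume "u \<in> (snd \<circ> snd) ` D"
      then obtain v j where "(v, j, u) \<in> D" by force
      from D(3,5)[OF this] show "u \<in> F" using S.Inc_Points by (auto simp: F_def)
    qed
    ultimately show ?thesis by simp
  qed
  have disj: "point_fibre l c \<inter> (snd \<circ> snd) ` D = {}"
  proof -
    have "u \<notin> point_fibre l c" if "(v, j, u) \<in> D" for v j u
      using D(4)[OF that] by (simp add: point_fibre_def)
    then show ?thesis by fastforce
  qed
  have "card D = (\<Sum>v\<in>point_fibre l c. card (SIGMA j:P v. point_fibre j c - {v}))"
    unfolding D_def by (intro card_SigmaI ballI finite_SigmaI finite_point_fibre finP finite_Diff)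
  also have "\<dots> = (\<Sum>v\<in>point_fibre l c. 2 * n * (m - 1))"
  proof (rule sum.cong[OF refl])
    fix v assume "v \<in> point_fibre l c"
    then have v: "v \<in> Points S" "f v = c" using S.Inc_Points by (auto simp: point_fibre_def)
    have "card (P v) = card (line_fibre v M) + card (line_fibre v M')"
      unfolding P_def using M'(3) by (intro card_Un_disjoint finite_line_fibre) (auto simp: line_fibre_def)
    also have "\<dots> = 2 * n"
      unfolding nM[OF v(1), unfolded v(2), OF M(1)] nM'[OF v(1), unfolded v(2), OF M'(1)]
      by (rule mult_2[symmetric])
    finally have P: "card (P v) = 2 * n" .
    have "card (SIGMA j:P v. point_fibre j c - {v}) = (\<Sum>j\<in>P v. card (point_fibre j c - {v}))"
      by (intro card_SigmaI ballI finite_point_fibre finP finite_Diff)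
    also have "\<dots> = (\<Sum>j\<in>P v. m - 1)"
    proof (rule sum.cong[OF refl])
      fix j assume "j \<in> P v"
      then have j: "(v, j) \<in> Inc S" "(c, g j) \<in> Inc T"
        using M(1) M'(1) by (auto simp: P_def line_fibre_def)
      then have "v \<in> point_fibre j c" using v by (simp add: point_fibre_def)
      then show "card (point_fibre j c - {v}) = m - 1"
        unfolding mc[OF S.Inc_Lines[OF j(1)] j(2), symmetric] by (rule card_Diff_singleton)
    qed
    finally show "card (SIGMA j:P v. point_fibre j c - {v}) = 2 * n * (m - 1)"
      unfolding P[symmetric] sum_constant of_nat_id .
  qed
  finally have cD: "card D = m * (2 * n * (m - 1))" by (simp add: m_def)
  have "m + m * (2 * n * (m - 1)) = card (point_fibre l c) + card ((snd \<circ> snd) ` D)"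
    unfolding card_image[OF inj] cD by (simp add: m_def)
  also have "\<dots> = card (point_fibre l c \<union> (snd \<circ> snd) ` D)"
    using disj finD finite_point_fibre by (intro card_Un_disjoint[symmetric]) auto
  also have "\<dots> \<le> card F" using sub finF by (rule card_mono[rotated])
  also note upper
  finally have "m * (1 + 2 * n * (m - 1)) \<le> m * (n * m)" by (simp add: algebra_simps)
  then have *: "1 + 2 * n * (m - 1) \<le> n * m" using m2 by (metis mult_le_cancel1 not_numeral_le_zero gr_zeroI)
  \<comment> \<open>With \<open>m = r + 2\<close> the inequality amounts to
    \<open>1 + n * r \<le> 0\<close>.\<close>
  obtain r where "m = Suc (Suc r)" using m2 by (metis add_2_eq_Suc le_Suc_ex)
  then show False using * by (simp add: algebra_simps)
qed

lemma inj_on_pencil: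
  assumes "(x, l) \<in> Inc S" "(x, k) \<in> Inc S" "g l = g k"
  shows "l = k"
proof -
  interpret D: gq_epi "dual S" "dual T" g f by (rule gq_epi_dual)
  show ?thesis using D.inj_on_line[of l x k] assms by simp
qed

text \<open>Points with equal image are projected onto a line \<open>k\<close> whose image misses
  that image. The feet agree by injectivity on \<open>k\<close>, then the joining lines by
  injectivity on pencils, then the points themselves.\<close>

theorem inj_on_Points: "inj_on f (Points S)"
proof (rule inj_onI)
  fix x w assume x: "x \<in> Points S" and w: "w \<in> Points S" and eq: "f x = f w"
  obtain M where M: "(f x, M) \<in> Inc T" using T.line_obtain f_Points[OF x] by metis
  obtain y where y: "(y, M) \<in> Inc T" "y \<noteq> f x" using T.point_obtain T.Inc_Lines[OF M] by metis
  obtain K where K: "(y, K) \<in> Inc T" "K \<noteq> M" using T.line_obtain T.Inc_Points[OF y(1)] by metis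
  obtain k where k: "k \<in> Lines S" "g k = K"
    using preimage_line[OF K(1)] by blast
  have nK: "(f x, g k) \<notin> Inc T" using T.join_unique M y K k by metis
  obtain q m where q: "(x, m) \<in> Inc S" "(q, m) \<in> Inc S" "(q, k) \<in> Inc S" "f q = y" "g m = M"
    using proj_lift[of x k M y] x k nK M y K by blast
  obtain q' m' where q': "(w, m') \<in> Inc S" "(q', m') \<in> Inc S" "(q', k) \<in> Inc S" "f q' = y" "g m' = M"
    using proj_lift[of w k M y] w k nK M y K eq by metis
  have "q = q'" using inj_on_line q q' by metis
  then have "m = m'" using inj_on_pencil q q' by metis
  then show "x = w" using inj_on_line q q' eq by metis
qed

end

section \<open>Hyperplanes\<close>

locale gq_hyperplane = gen_quad S
  for S :: "('p, 'l) geometry" +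
  fixes H :: "('p, 'l) geometry"
  assumes hyp: "geometrical_hyperplane H S"
begin

lemma sub: "Points H \<subseteq> Points S" "Lines H \<subseteq> Lines S"
  and Inc_H: "Inc H = Inc S \<inter> (Points H \<times> Lines H)"
  using hyp unfolding geometrical_hyperplane_def subgeometry_def by auto

lemma line_meets:
  assumes "l \<in> Lines S"
  obtains p where "(p, l) \<in> Inc S" "p \<in> Points H"
proof (cases "l \<in> Lines H")
  case True
  then have "points_on S l \<subseteq> Points H" using hyp assms unfolding geometrical_hyperplane_def by blast
  then show ?thesis using that point_obtain[OF assms] unfolding points_on_def by blast
next
  case False
  then show ?thesis
    using that hyp assms unfolding geometrical_hyperplane_def points_on_def by blast
qed

lemma line_full:
  assumes "l \<in> Lines H" "(p, l) \<in> Inc S"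
  shows "p \<in> Points H"
  using hyp assms Inc_Lines[OF assms(2)]
  unfolding geometrical_hyperplane_def points_on_def by blast

lemma line_inside:
  assumes "(p, l) \<in> Inc S" "(q, l) \<in> Inc S" "p \<in> Points H" "q \<in> Points H" "p \<noteq> q"
  shows "l \<in> Lines H"
  using hyp assms Inc_Lines[OF assms(1)]
  unfolding geometrical_hyperplane_def points_on_def by blast

text \<open>Properness is stated for the geometry as a whole. If all points were in
  \<open>H\<close>, each line would have two points in \<open>H\<close> and so belong to it, leaving
  no difference between \<open>H\<close> and \<open>S\<close>.\<close>

lemma ex_outside_point: "\<exists>p\<in>Points S. p \<notin> Points H"
proof (rule ccontr)
  assume "\<not> ?thesis"
  then have P: "Points H = Points S" using sub by blast
  have "l \<in> Lines H" if l: "l \<in> Lines S" for l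
  proof -
    obtain p where p: "(p, l) \<in> Inc S" using point_obtain l by metis
    obtain q where q: "(q, l) \<in> Inc S" "q \<noteq> p" using point_obtain l by metis
    then show ?thesis using p q line_inside P Inc_Points by metis
  qed
  then have L: "Lines H = Lines S" using sub by blast
  have "Inc H = Inc S" using Inc_H P L Inc_Points Inc_Lines by auto
  then have "H = S" using P L by simp
  then show False using hyp unfolding geometrical_hyperplane_def by blast
qed

text \<open>The foot lies in \<open>H\<close> because lines of \<open>H\<close> are full, and then
  the joining line has two points in \<open>H\<close>.\<close>

lemma proj_inside:
  assumes "p \<in> Points H" "l \<in> Lines H" "(p, l) \<notin> Inc S"
  obtains q m where "(p, m) \<in> Inc S" "(q, m) \<in> Inc S" "(q, l) \<in> Inc S" "m \<in> Lines H" "q \<in> Points H"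
proof -
  obtain q m where qm: "(p, m) \<in> Inc S" "(q, m) \<in> Inc S" "(q, l) \<in> Inc S"
    using proj_obtain[OF subsetD[OF sub(1) assms(1)] subsetD[OF sub(2) assms(2)] assms(3)] by metis
  moreover have "q \<in> Points H" by (rule line_full[OF assms(2) qm(3)])
  moreover have "m \<in> Lines H" using line_inside qm assms \<open>q \<in> Points H\<close> by metis
  ultimately show ?thesis using that by blast
qed

text \<open>A point off a given line of \<open>H\<close> projects onto it along a line of
  \<open>H\<close>, so isolated points occur only when \<open>H\<close> has no lines.\<close>

lemma point_on_line:
  assumes "Lines H \<noteq> {}" "p \<in> Points H"
  obtains l where "l \<in> Lines H" "(p, l) \<in> Inc S"
  using assms proj_inside by (metis ex_in_conv)

lemma type_B_if_concurrent:
  assumes ne: "Lines H \<noteq> {}" and x: "x \<in> Points S" and conc: "\<And>l. l \<in> Lines H \<Longrightarrow> (x, l) \<in> Inc S"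
  shows "hyperplane_type_B H S"
proof -
  have through: "m \<in> Lines H" if m: "(x, m) \<in> Inc S" for m
  \<comment> \<open>A line \<open>m\<close> through \<open>x\<close> outside \<open>H\<close> would
    close a triangle with a second line \<open>k\<close> through a point of \<open>m\<close> and a
    line of \<open>H\<close> through the point of \<open>H\<close> on \<open>k\<close>.\<close>
  proof (rule ccontr)
    assume mH: "m \<notin> Lines H"
    obtain y where y: "(y, m) \<in> Inc S" "y \<noteq> x" using point_obtain Inc_Lines[OF m] by metis
    obtain k where k: "(y, k) \<in> Inc S" "k \<noteq> m" using line_obtain Inc_Points[OF y(1)] by metis
    obtain z where z: "(z, k) \<in> Inc S" "z \<in> Points H" using line_meets Inc_Lines[OF k(1)] by metis
    obtain h where h: "h \<in> Lines H" "(z, h) \<in> Inc S" using point_on_line ne z(2) by metis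
    have xh: "(x, h) \<in> Inc S" using conc h by blast
    have "z \<noteq> x" using join_unique m y k z by metis
    moreover have "h \<noteq> m" using h mH by blast
    ultimately have "h = k" using no_triangle[of x m y k z h] m y k z h xh by metis
    then show False using join_unique[of x k y m] xh k y m by metis
  qed
  have "Points H = {y \<in> Points S. collinear S x y}"
  proof
    show "Points H \<subseteq> {y \<in> Points S. collinear S x y}"
    proof
      fix y assume y: "y \<in> Points H"
      then obtain l where "l \<in> Lines H" "(y, l) \<in> Inc S" using point_on_line ne by metis
      then show "y \<in> {y \<in> Points S. collinear S x y}"
        using conc sub y unfolding collinear_def by blast
    qed
    show "{y \<in> Points S. collinear S x y} \<subseteq> Points H"
      using through line_full unfolding collinear_def by blast
  qed
  moreover have "Lines H = lines_through S x"
    using through conc unfolding lines_through_def by blast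
  ultimately show ?thesis using hyp x unfolding hyperplane_type_B_def by blast
qed

text \<open>If \<open>p\<close> is on a single line \<open>N\<close> of \<open>H\<close>,
  projections from \<open>p\<close> inside \<open>H\<close> run along \<open>N\<close>, so all lines
  of \<open>H\<close> meet \<open>N\<close>. Excluding triangles makes them concurrent, which is
  type B.\<close>

lemma two_lines:
  assumes ne: "Lines H \<noteq> {}" and notB: "\<not> hyperplane_type_B H S" and p: "p \<in> Points H"
  shows "at_least 2 (lines_through H p)"
proof (rule ccontr)
  assume less: "\<not> ?thesis"
  obtain N where N: "N \<in> Lines H" "(p, N) \<in> Inc S" using point_on_line ne p by metis
  have only: "l = N" if "l \<in> Lines H" "(p, l) \<in> Inc S" for l
    using less at_least_2I[of l "lines_through H p" N] that N p
    unfolding lines_through_def Inc_H by auto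
  have meets: "\<exists>q. (q, l) \<in> Inc S \<and> (q, N) \<in> Inc S" if l: "l \<in> Lines H" for l
  proof (cases "(p, l) \<in> Inc S")
    case True
    then show ?thesis using N by blast
  next
    case False
    then show ?thesis using proj_inside[OF p l] only by metis
  qed
  \<comment> \<open>A line disjoint from \<open>N\<close> still meets \<open>H\<close>, and a line
    of \<open>H\<close> through that point differs from \<open>N\<close>.\<close>
  obtain k where k: "k \<in> Lines S" "\<And>p. (p, k) \<in> Inc S \<Longrightarrow> (p, N) \<notin> Inc S"
    using disjoint_line_obtain[of N] N sub by blast
  obtain r where r: "(r, k) \<in> Inc S" "r \<in> Points H" using line_meets k(1) by metis
  obtain l where l: "l \<in> Lines H" "(r, l) \<in> Inc S" using point_on_line ne r(2) by metis
  have lN: "l \<noteq> N" using l k r by blast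
  obtain x where x: "(x, l) \<in> Inc S" "(x, N) \<in> Inc S" using meets l by blast
  have "(x, h) \<in> Inc S" if h: "h \<in> Lines H" for h
  proof (rule ccontr)
    assume xh: "(x, h) \<notin> Inc S"
    obtain y where y: "(y, h) \<in> Inc S" "(y, N) \<in> Inc S" using meets h by blast
    have xy: "x \<noteq> y" using xh y by blast
    have hN: "h \<noteq> N" using xh x by blast
    \<comment> \<open>Joining a point \<open>a\<close> of \<open>l\<close> to \<open>h\<close>
      inside \<open>H\<close> gives a line \<open>m\<close> that must meet \<open>N\<close>. This
      forces \<open>m = l\<close>, so \<open>l\<close> contains both \<open>x\<close> and
      \<open>y\<close> and equals \<open>N\<close>.\<close>
    obtain a where a: "(a, l) \<in> Inc S" "a \<noteq> x" using point_obtain Inc_Lines[OF x(1)] by metis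
    have aN: "(a, N) \<notin> Inc S" using join_unique a x lN by metis
    have ah: "(a, h) \<notin> Inc S"
      using proj_unique(1)[OF xh, of N y l a] x y a aN by auto
    obtain b m where b: "(a, m) \<in> Inc S" "(b, m) \<in> Inc S" "(b, h) \<in> Inc S" "m \<in> Lines H"
      using proj_inside[of a h] line_full[OF l(1) a(1)] h ah by metis
    obtain c where c: "(c, m) \<in> Inc S" "(c, N) \<in> Inc S" using meets b by blast
    have "c = x" "m = l" using proj_unique[OF aN, of m c l x] b c a x by auto
    then have "b = y" using proj_unique(1)[OF xh, of N y l b] x y b by auto
    then show False using join_unique[of x N y l] \<open>m = l\<close> x y b lN xy by metis
  qed
  then show False using type_B_if_concurrent[OF ne Inc_Points[OF x(1)]] notB by blast
qed

text \<open>Excluding type B secures two lines through each point; projections stay inside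
  \<open>H\<close> by \<open>proj_inside\<close>. The resulting quadrangle may be a grid, so its
  thickness is a separate hypothesis of the main theorem.\<close>

lemma type_C:
  assumes ne: "Lines H \<noteq> {}" and notB: "\<not> hyperplane_type_B H S"
  shows "hyperplane_type_C H S"
proof -
  have pts: "points_on H l = points_on S l" if "l \<in> Lines H" for l
    using that line_full unfolding points_on_def Inc_H by auto
  have "point_line_geometry H" using Inc_H unfolding point_line_geometry_def by auto
  moreover have "Points H \<noteq> {}"
    using ne sub point_obtain line_full by (metis empty_iff ex_in_conv subsetD)
  moreover have "\<forall>l\<in>Lines H. at_least 2 (points_on H l)"
    using pts sub gq unfolding generalized_quadrangle_def by auto
  moreover have "\<forall>p\<in>Points H. at_least 2 (lines_through H p)"
    using two_lines ne notB by blast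
  moreover have "\<forall>p q l m. (p, l) \<in> Inc H \<and> (q, l) \<in> Inc H \<and> (p, m) \<in> Inc H \<and> (q, m) \<in> Inc H
      \<longrightarrow> p = q \<or> l = m"
    using join_unique unfolding Inc_H by blast
  moreover have "\<exists>!(q, m). (p, m) \<in> Inc H \<and> (q, m) \<in> Inc H \<and> (q, l) \<in> Inc H"
    if p: "p \<in> Points H" and l: "l \<in> Lines H" and "(p, l) \<notin> Inc H" for p l
  proof -
    have pl: "(p, l) \<notin> Inc S" using that Inc_H by blast
    obtain q m where qm: "(p, m) \<in> Inc S" "(q, m) \<in> Inc S" "(q, l) \<in> Inc S" "m \<in> Lines H" "q \<in> Points H"
      using proj_inside[OF p l pl] by metis
    show ?thesis
    proof (rule ex1I[of _ "(q, m)"])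
      show "case (q, m) of (q, m) \<Rightarrow> (p, m) \<in> Inc H \<and> (q, m) \<in> Inc H \<and> (q, l) \<in> Inc H"
        using qm that unfolding Inc_H by auto
      fix z assume "case z of (q, m) \<Rightarrow> (p, m) \<in> Inc H \<and> (q, m) \<in> Inc H \<and> (q, l) \<in> Inc H"
      then show "z = (q, m)"
        using proj_unique[OF pl qm(1-3)] unfolding Inc_H by (cases z) auto
    qed
  qed
  ultimately have "generalized_quadrangle H" unfolding generalized_quadrangle_def by blast
  moreover have "\<forall>l\<in>Lines S. points_on S l \<inter> Points H \<noteq> {}"
    using line_meets unfolding points_on_def by blast
  ultimately show ?thesis
    using hyp line_full
    unfolding hyperplane_type_C_def full_subquadrangle_def geometrical_hyperplane_def points_on_def
    by blast
qed

end

section \<open>Spreading from a line outside a hyperplane\<close>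

locale thick_gq_hyperplane = thick_gen_quad S + gq_hyperplane S H
  for S H :: "('p, 'l) geometry"
begin

text \<open>\<open>PA\<close> and \<open>LA\<close> will be the image of the morphism. Membership
  passes from a line outside \<open>H\<close> to lines meeting it outside \<open>H\<close>, then to
  disjoint lines, and finally to lines meeting it inside \<open>H\<close>.\<close>

lemma generated_by_outside_line:
  assumes PA: "Points H \<subseteq> PA" and LA: "Lines H \<subseteq> LA"
    and closed: "\<And>p l q m. \<lbrakk>p \<in> PA; l \<in> LA; (p, l) \<notin> Inc S; (p, m) \<in> Inc S; (q, m) \<in> Inc S; (q, l) \<in> Inc S\<rbrakk>
      \<Longrightarrow> q \<in> PA \<and> m \<in> LA"
    and l: "l \<in> LA" "l \<in> Lines S" "l \<notin> Lines H"
  shows "Points S \<subseteq> PA" and "Lines S \<subseteq> LA"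
proof -
  \<comment> \<open>The line \<open>m\<close> carries a point of \<open>H\<close>, whose projection
    onto \<open>k\<close> is \<open>y\<close> along \<open>m\<close>.\<close>
  have spread: "m \<in> LA \<and> y \<in> PA"
    if k: "k \<in> LA" and y: "(y, k) \<in> Inc S" "y \<notin> Points H" and m: "(y, m) \<in> Inc S" "m \<noteq> k" for k y m
  proof -
    obtain z where z: "(z, m) \<in> Inc S" "z \<in> Points H" using line_meets Inc_Lines[OF m(1)] by metis
    have "(z, k) \<notin> Inc S" using join_unique z y m by metis
    then show ?thesis using closed[of z k m y] z k y m PA by blast
  qed
  have out1: "p = q" if "k \<notin> Lines H" "(p, k) \<in> Inc S" "(q, k) \<in> Inc S" "p \<in> Points H" "q \<in> Points H" for p q k
    using line_inside that by blast
  have skew: "m \<in> LA"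
    if k: "k \<in> LA" "k \<notin> Lines H" "k \<in> Lines S" and m: "m \<in> Lines S" "m \<notin> Lines H"
      and disj: "\<And>p. (p, k) \<in> Inc S \<Longrightarrow> (p, m) \<notin> Inc S" for k m
  proof -
    obtain a where a: "(a, k) \<in> Inc S" "a \<in> Points H" using line_meets k by metis
    obtain b where b: "(b, m) \<in> Inc S" "b \<in> Points H" using line_meets m by metis
    have bk: "(b, k) \<notin> Inc S" using disj b by blast
    obtain c n where c: "(b, n) \<in> Inc S" "(c, n) \<in> Inc S" "(c, k) \<in> Inc S"
      using proj_obtain[of b k] bk Inc_Points[OF b(1)] k by metis
    \<comment> \<open>Avoiding \<open>a\<close> keeps \<open>y\<close> outside \<open>H\<close>;
      avoiding \<open>c\<close> keeps the projection of \<open>y\<close> onto \<open>m\<close>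
      different from \<open>b\<close>, hence also outside \<open>H\<close>. Membership then spreads
      from \<open>k\<close> over \<open>j\<close> to \<open>m\<close>.\<close>
    obtain y where y: "(y, k) \<in> Inc S" "y \<noteq> a" "y \<noteq> c" using third_point_obtain k by metis
    have yH: "y \<notin> Points H" using out1 k y a by metis
    obtain z j where z: "(y, j) \<in> Inc S" "(z, j) \<in> Inc S" "(z, m) \<in> Inc S"
      using proj_obtain[of y m] disj y m Inc_Points by metis
    have "z \<noteq> b" using proj_unique(1)[OF bk c, of j y] z y by metis
    then have zH: "z \<notin> Points H" using out1 m z b by metis
    have "j \<noteq> k" using disj z by blast
    then have "j \<in> LA" using spread k y yH z by metis
    moreover have "j \<noteq> m" using disj z y by blast
    ultimately show ?thesis using spread z zH by metis
  qed
  have all_out: "m \<in> LA" if m: "m \<in> Lines S" "m \<notin> Lines H" for m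
  proof (cases "\<exists>p. (p, l) \<in> Inc S \<and> (p, m) \<in> Inc S")
    case False
    then show ?thesis using skew[of l m] l m by blast
  next
    case True
    then obtain p where p: "(p, l) \<in> Inc S" "(p, m) \<in> Inc S" by blast
    show ?thesis
    proof (cases "l = m")
      case True
      then show ?thesis using l by simp
    next
      case lm: False
      show ?thesis
      proof (cases "p \<in> Points H")
        case False
        then show ?thesis using spread l p lm by metis
      next
        case pH: True
        \<comment> \<open>Membership cannot spread through \<open>p\<close>, so \<open>l\<close> is
          exchanged for a line \<open>k\<close> through another point \<open>y\<close>. It is
          disjoint from \<open>m\<close>, since \<open>y\<close> projects onto \<open>m\<close>
          along \<open>l\<close>.\<close>
        obtain y where y: "(y, l) \<in> Inc S" "y \<noteq> p" using point_obtain l by metis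
        have yH: "y \<notin> Points H" using out1 l p y pH by metis
        obtain k where k: "(y, k) \<in> Inc S" "k \<noteq> l" using line_obtain Inc_Points[OF y(1)] by metis
        have kH: "k \<notin> Lines H" using line_full k yH by blast
        have kLA: "k \<in> LA" using spread l y yH k by metis
        have ym: "(y, m) \<notin> Inc S" using join_unique lm p y by metis
        have "(q, m) \<notin> Inc S" if "(q, k) \<in> Inc S" for q
          using proj_unique(2)[OF ym y(1) p(1) p(2) k(1) that] k by auto
        then show ?thesis using skew[OF kLA kH Inc_Lines[OF k(1)] m] by blast
      qed
    qed
  qed
  show "Lines S \<subseteq> LA" using all_out LA by blast
  show "Points S \<subseteq> PA"
  proof
    fix y assume y: "y \<in> Points S"
    show "y \<in> PA"
    proof (cases "y \<in> Points H")
      case True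
      then show ?thesis using PA by blast
    next
      case yH: False
      obtain k where k: "(y, k) \<in> Inc S" using line_obtain y by metis
      obtain m where m: "(y, m) \<in> Inc S" "m \<noteq> k" using line_obtain y by metis
      have "k \<in> LA" using all_out line_full k yH Inc_Lines by metis
      then show ?thesis using spread k yH m by metis
    qed
  qed
qed

end

section \<open>Surjectivity of the morphism\<close>

theorem theorem7p3:
  fixes \<Delta> \<G> :: "('p, 'l) geometry"
    and \<Delta>' \<G>' :: "('q, 'm) geometry"
    and \<phi>P :: "'p \<Rightarrow> 'q" and \<phi>L :: "'l \<Rightarrow> 'm"
  assumes "generalized_quadrangle \<Delta>" and "thick \<Delta>" and "finite_geometry \<Delta>"
    and "generalized_quadrangle \<Delta>'" and "thick \<Delta>'" and "finite_geometry \<Delta>'"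
    and "morphism \<Delta> \<Delta>' \<phi>P \<phi>L"
    and "geometrical_hyperplane \<G> \<Delta>"
    and "geometrical_hyperplane \<G>' \<Delta>'"
    and "maps_onto \<phi>P \<phi>L \<G> \<G>'"
    and "\<not> hyperplane_type_B \<G>' \<Delta>'"
    and "hyperplane_type_C \<G>' \<Delta>' \<Longrightarrow> thick \<G>'"
  shows "maps_onto \<phi>P \<phi>L \<Delta> \<Delta>'"
proof -
  interpret D: gq_hyperplane \<Delta> \<G> by unfold_locales (rule assms)+
  interpret D': thick_gq_hyperplane \<Delta>' \<G>' by unfold_locales (rule assms)+
  have mor: "\<phi>P ` Points \<Delta> \<subseteq> Points \<Delta>'" "\<phi>L ` Lines \<Delta> \<subseteq> Lines \<Delta>'"
    "\<And>p l. (p, l) \<in> Inc \<Delta> \<Longrightarrow> (\<phi>P p, \<phi>L l) \<in> Inc \<Delta>'"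
    using assms(7) unfolding morphism_def by auto
  have G': "Points \<G>' = \<phi>P ` Points \<G>" "Lines \<G>' = \<phi>L ` Lines \<G>"
    using assms(10) unfolding maps_onto_def by auto
  have sub: "Points \<G>' \<subseteq> \<phi>P ` Points \<Delta>" "Lines \<G>' \<subseteq> \<phi>L ` Lines \<Delta>"
    using G' D.sub by auto
  \<comment> \<open>Otherwise all of \<open>\<Delta>\<close> maps onto \<open>\<G>'\<close>, against
    the injectivity of epimorphisms.\<close>
  have "\<exists>l\<in>Lines \<Delta>. \<phi>L l \<notin> Lines \<G>'"
  proof (rule ccontr)
    assume "\<not> ?thesis"
    then have L: "\<phi>L l \<in> Lines \<G>'" if "l \<in> Lines \<Delta>" for l using that by blast
    have P: "\<phi>P p \<in> Points \<G>'" if "p \<in> Points \<Delta>" for p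
    proof -
      obtain l where l: "(p, l) \<in> Inc \<Delta>" using D.line_obtain \<open>p \<in> Points \<Delta>\<close> by metis
      then show ?thesis using D'.line_full[of "\<phi>L l" "\<phi>P p"] L D.Inc_Lines mor by blast
    qed
    obtain p where p: "p \<in> Points \<Delta>" "p \<notin> Points \<G>" using D.ex_outside_point by blast
    obtain l where l: "(p, l) \<in> Inc \<Delta>" using D.line_obtain p by metis
    \<comment> \<open>Having a line rules out ovoids, and type B is excluded by hypothesis.\<close>
    have "Lines \<G>' \<noteq> {}" using L D.Inc_Lines[OF l] by blast
    then have C: "hyperplane_type_C \<G>' \<Delta>'" using D'.type_C assms(11) by blast
    interpret E: gq_epi \<Delta> \<G>' \<phi>P \<phi>L
    proof
      show "generalized_quadrangle \<G>'"
        using C unfolding hyperplane_type_C_def full_subquadrangle_def by blast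
      show "thick \<G>'" using assms(12) C .
      show "finite_geometry \<Delta>" by (rule assms)
      show "morphism \<Delta> \<G>' \<phi>P \<phi>L"
        unfolding morphism_def
      proof (intro conjI allI impI image_subsetI)
        fix p l assume pl: "(p, l) \<in> Inc \<Delta>"
        show "(\<phi>P p, \<phi>L l) \<in> Inc \<G>'"
          unfolding D'.Inc_H using mor(3)[OF pl] P[OF D.Inc_Points[OF pl]] L[OF D.Inc_Lines[OF pl]] by simp
      qed (fact P L)+
      show "maps_onto \<phi>P \<phi>L \<Delta> \<G>'"
        unfolding maps_onto_def using sub
        by (intro conjI subset_antisym image_subsetI P L)
    qed
    \<comment> \<open>Since \<open>\<G>\<close> already covers \<open>\<G>'\<close>, the outside
      point \<open>p\<close> shares its image with a point of \<open>\<G>\<close>.\<close>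
    obtain w where w: "w \<in> Points \<G>" "\<phi>P p = \<phi>P w" using P[OF p(1)] G' by auto
    then have "p = w" using E.inj_on_Points p D.sub unfolding inj_on_def by blast
    then show False using w p by blast
  qed
  then obtain l where l: "l \<in> Lines \<Delta>" "\<phi>L l \<notin> Lines \<G>'" by blast
  \<comment> \<open>Projections in \<open>\<Delta>\<close> map to projections in
    \<open>\<Delta>'\<close>, which are unique.\<close>
  have closed: "q \<in> \<phi>P ` Points \<Delta> \<and> m \<in> \<phi>L ` Lines \<Delta>"
    if "p \<in> \<phi>P ` Points \<Delta>" "k \<in> \<phi>L ` Lines \<Delta>" "(p, k) \<notin> Inc \<Delta>'"
      "(p, m) \<in> Inc \<Delta>'" "(q, m) \<in> Inc \<Delta>'" "(q, k) \<in> Inc \<Delta>'" for p k q m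
  proof -
    obtain a where a: "a \<in> Points \<Delta>" "p = \<phi>P a" using \<open>p \<in> \<phi>P ` Points \<Delta>\<close> by blast
    obtain b where b: "b \<in> Lines \<Delta>" "k = \<phi>L b" using \<open>k \<in> \<phi>L ` Lines \<Delta>\<close> by blast
    have "(a, b) \<notin> Inc \<Delta>" using that(3) a b mor by blast
    then obtain c n where c: "(a, n) \<in> Inc \<Delta>" "(c, n) \<in> Inc \<Delta>" "(c, b) \<in> Inc \<Delta>"
      using D.proj_obtain a b by metis
    then have "q = \<phi>P c" "m = \<phi>L n"
      using D'.proj_unique[OF that(3-6), of "\<phi>L n" "\<phi>P c"] mor(3) a b by auto
    then show ?thesis using c D.Inc_Points D.Inc_Lines by blast
  qed
  have "\<phi>L l \<in> Lines \<Delta>'" using l(1) mor(2) by blast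
  then have "Points \<Delta>' \<subseteq> \<phi>P ` Points \<Delta>" "Lines \<Delta>' \<subseteq> \<phi>L ` Lines \<Delta>"
    using D'.generated_by_outside_line[OF sub closed imageI[OF l(1)] _ l(2)] by simp_all
  then show ?thesis unfolding maps_onto_def using mor by blast
qed

end
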